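(* Let $\alpha_1,\alpha_2\in\mathbb{R}$ be incommensurable, i.e. $\alpha_1\mathbb{Z}\cap\alpha_2\mathbb{Z}=\{0\}$. Then each function $f:\mathbb{R}\to\mathbb{R}$ satisfying $\Delta_{\alpha_1}\Delta_{\alpha_2}f=0$ on $\mathbb{R}$ can be written as $f=f_1+f_2$ with functions $f_1,f_2:\mathbb{R}\to\mathbb{R}$ such that $f_1(x+\alpha_1)=f_1(x)$ and $f_2(x+\alpha_2)=f_2(x)$ for all $x\in\mathbb{R}$.
   Context: For $\alpha\in\mathbb{R}$ and $g:\mathbb{R}\to\mathbb{R}$, the difference operator is $\Delta_\alpha g(x):=g(x+\alpha)-g(x)$. No regularity (continuity, measurability, boundedness) of the functions is assumed. *)

theory Defs
  imports Complex_Main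
begin

definition diff_op :: "real \<Rightarrow> (real \<Rightarrow> real) \<Rightarrow> real \<Rightarrow> real" where
  "diff_op \<alpha> g = (\<lambda>x. g (x + \<alpha>) - g x)"

text \<open>A zero argument is not excluded: \<open>incommensurable 0 \<beta>\<close> holds for every \<open>\<beta>\<close>.\<close>

definition incommensurable :: "real \<Rightarrow> real \<Rightarrow> bool" where
  "incommensurable \<alpha> \<beta> \<longleftrightarrow> range (\<lambda>m::int. \<alpha> * of_int m) \<inter> range (\<lambda>n::int. \<beta> * of_int n) = {0}"

end

theory Submission
  imports Defs
begin

text \<open>
  The equation \<open>\<Delta>\<^sub>\<alpha>\<^sub>1\<Delta>\<^sub>\<alpha>\<^sub>2 f = 0\<close> is a statement about each coset of the group
  \<open>\<alpha>\<^sub>1\<int> + \<alpha>\<^sub>2\<int>\<close> separately. Choose a base point \<open>r\<close> in every coset. Summing the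
  equation over a rectangle gives \<open>f (r + a + b) = f (r + a) + f (r + b) - f r\<close> for
  \<open>a \<in> \<alpha>\<^sub>1\<int>\<close> and \<open>b \<in> \<alpha>\<^sub>2\<int>\<close> (\<open>rectangle_rule\<close>). By incommensurability a point of
  the coset determines its two components \<open>a\<close> and \<open>b\<close> (\<open>incommensurable_components_unique\<close>),
  so \<open>f1 (r + a + b) = f (r + b)\<close> and \<open>f2 (r + a + b) = f (r + a) - f r\<close> are well defined.
  A shift by \<open>\<alpha>\<^sub>1\<close> changes \<open>a\<close> alone and a shift by \<open>\<alpha>\<^sub>2\<close> changes \<open>b\<close> alone,
  so these functions have the required periods.

  Working with the components \<open>a\<close>, \<open>b\<close> instead of their integer coefficients matters
  when \<open>\<alpha>\<^sub>1\<close> or \<open>\<alpha>\<^sub>2\<close> is zero: the coefficients are then not unique, but the components still are.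
\<close>

lemma periodic_int_multiple:
  fixes h :: "real \<Rightarrow> 'b"
  assumes periodic: "\<And>x. h (x + \<alpha>) = h x"
  shows "h (x + \<alpha> * of_int m) = h x"
proof (induction m arbitrary: x rule: int_induct[where k = 0])
  case base
  show ?case by simp
next
  case (step1 i)
  show ?case
    using step1.IH[of x] periodic[of "x + \<alpha> * of_int i"] by (simp add: algebra_simps)
next
  case (step2 i)
  show ?case
    using step2.IH[of x] periodic[of "x + \<alpha> * of_int (i - 1)"] by (simp add: algebra_simps)
qed

text \<open>
  The hypothesis says that \<open>\<Delta>\<^sub>\<beta> f\<close> has period \<open>\<alpha>\<close>. Hence it also has period \<open>m\<alpha>\<close>, and since
  difference operators commute this says that \<open>\<Delta>\<^sub>m\<^sub>\<alpha> f\<close> has period \<open>\<beta>\<close>, hence also \<open>n\<beta>\<close>.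
\<close>

lemma rectangle_rule:
  assumes "\<forall>x. diff_op \<alpha> (diff_op \<beta> f) x = 0"
  shows "f (x + \<alpha> * of_int m + \<beta> * of_int n)
       = f (x + \<alpha> * of_int m) + f (x + \<beta> * of_int n) - f x"
proof -
  have "diff_op \<beta> f (y + \<alpha>) = diff_op \<beta> f y" for y
    using assms unfolding diff_op_def by (auto simp: algebra_simps)
  then have shift_m: "diff_op \<beta> f (y + \<alpha> * of_int m) = diff_op \<beta> f y" for y
    by (rule periodic_int_multiple)
  have "diff_op (\<alpha> * of_int m) f (y + \<beta>) = diff_op (\<alpha> * of_int m) f y" for y
    using shift_m[of y] unfolding diff_op_def by (simp add: algebra_simps)
  then have "diff_op (\<alpha> * of_int m) f (x + \<beta> * of_int n) = diff_op (\<alpha> * of_int m) f x"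
    by (rule periodic_int_multiple)
  then show ?thesis
    unfolding diff_op_def by (simp add: algebra_simps)
qed

lemma incommensurable_components_unique:
  assumes inc: "incommensurable \<alpha> \<beta>"
    and eq: "\<alpha> * of_int m + \<beta> * of_int n = \<alpha> * of_int m' + \<beta> * of_int n'"
  shows "\<alpha> * of_int m = \<alpha> * of_int m'" and "\<beta> * of_int n = \<beta> * of_int n'"
proof -
  have "\<alpha> * of_int (m - m') = \<beta> * of_int (n' - n)"
    using eq by (simp add: algebra_simps)
  then have "\<alpha> * of_int (m - m') \<in>
      range (\<lambda>m::int. \<alpha> * of_int m) \<inter> range (\<lambda>n::int. \<beta> * of_int n)"
    by (metis IntI rangeI)
  then have "\<alpha> * of_int (m - m') = 0"
    using inc unfolding incommensurable_def by blast
  then show "\<alpha> * of_int m = \<alpha> * of_int m'"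
    by (simp add: right_diff_distrib)
  with eq show "\<beta> * of_int n = \<beta> * of_int n'"
    by simp
qed

text \<open>
  The base point is chosen from the set of all points of the coset of \<open>x\<close>. A shift of \<open>x\<close> by a
  generator of \<open>\<alpha>\<int> + \<beta>\<int>\<close> leaves this set, and hence the choice, unchanged.
\<close>

lemma lattice_coset_representatives:
  fixes \<alpha> \<beta> :: real
  obtains r :: "real \<Rightarrow> real" and M N :: "real \<Rightarrow> int"
  where "\<And>x. x = r x + \<alpha> * of_int (M x) + \<beta> * of_int (N x)"
    and "\<And>x. r (x + \<alpha>) = r x" and "\<And>x. r (x + \<beta>) = r x"
proof -
  define C where "C x y \<longleftrightarrow> (\<exists>m n::int. x = y + \<alpha> * of_int m + \<beta> * of_int n)" for x y :: real
  define r where "r x = (SOME y. C x y)" for x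
  have "C x x" for x
    unfolding C_def by (intro exI[of _ 0]) simp
  then have "C x (r x)" for x
    unfolding r_def by (rule someI)
  then obtain M N :: "real \<Rightarrow> int" where
    decomp: "\<And>x. x = r x + \<alpha> * of_int (M x) + \<beta> * of_int (N x)"
    unfolding C_def by metis
  have shift: "C (x + \<alpha> * of_int i + \<beta> * of_int j) y" if "C x y" for x y and i j :: int
  proof -
    from that obtain m n :: int where "x = y + \<alpha> * of_int m + \<beta> * of_int n"
      unfolding C_def by blast
    then have "x + \<alpha> * of_int i + \<beta> * of_int j
        = y + \<alpha> * of_int (m + i) + \<beta> * of_int (n + j)"
      by (simp add: algebra_simps)
    then show ?thesis unfolding C_def by blast
  qed
  have "C (x + \<alpha>) = C x" for x
    using shift[of x _ 1 0] shift[of "x + \<alpha>" _ "-1" 0] by (intro ext) auto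
  moreover have "C (x + \<beta>) = C x" for x
    using shift[of x _ 0 1] shift[of "x + \<beta>" _ 0 "-1"] by (intro ext) auto
  ultimately show thesis
    using that[of r M N] decomp unfolding r_def by simp
qed

theorem proposition1p3:
  fixes \<alpha>1 \<alpha>2 :: real and f :: "real \<Rightarrow> real"
  assumes "incommensurable \<alpha>1 \<alpha>2"
    and "\<forall>x. diff_op \<alpha>1 (diff_op \<alpha>2 f) x = 0"
  shows "\<exists>f1 f2 :: real \<Rightarrow> real. (\<forall>x. f x = f1 x + f2 x) \<and>
           (\<forall>x. f1 (x + \<alpha>1) = f1 x) \<and> (\<forall>x. f2 (x + \<alpha>2) = f2 x)"
proof -
  obtain r :: "real \<Rightarrow> real" and M N :: "real \<Rightarrow> int" where
    decomp: "\<And>x. x = r x + \<alpha>1 * of_int (M x) + \<alpha>2 * of_int (N x)"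
    and r1: "\<And>x. r (x + \<alpha>1) = r x" and r2: "\<And>x. r (x + \<alpha>2) = r x"
    using lattice_coset_representatives[of \<alpha>1 \<alpha>2] by blast
  define f1 where "f1 x = f (r x + \<alpha>2 * of_int (N x))" for x
  define f2 where "f2 x = f (r x + \<alpha>1 * of_int (M x)) - f (r x)" for x
  have "f x = f1 x + f2 x" for x
    using rectangle_rule[OF assms(2), of "r x" "M x" "N x"] decomp[of x]
    unfolding f1_def f2_def by simp
  moreover have "f1 (x + \<alpha>1) = f1 x" for x
  proof -
    have "\<alpha>1 * of_int (M (x + \<alpha>1)) + \<alpha>2 * of_int (N (x + \<alpha>1))
        = \<alpha>1 * of_int (M x + 1) + \<alpha>2 * of_int (N x)"
      using decomp[of x] decomp[of "x + \<alpha>1"] r1[of x] by (simp add: algebra_simps)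
    from incommensurable_components_unique(2)[OF assms(1) this] show ?thesis
      unfolding f1_def r1 by (simp only:)
  qed
  moreover have "f2 (x + \<alpha>2) = f2 x" for x
  proof -
    have "\<alpha>1 * of_int (M (x + \<alpha>2)) + \<alpha>2 * of_int (N (x + \<alpha>2))
        = \<alpha>1 * of_int (M x) + \<alpha>2 * of_int (N x + 1)"
      using decomp[of x] decomp[of "x + \<alpha>2"] r2[of x] by (simp add: algebra_simps)
    from incommensurable_components_unique(1)[OF assms(1) this] show ?thesis
      unfolding f2_def r2 by (simp only:)
  qed
  ultimately show ?thesis by blast
qed

end
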